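(* There exists an atomic Puiseux monoid $M$ such that $$\{|\mathsf{L}(x)| \mid x \in M\} = \{1, \infty\}.$$
   Context: A Puiseux monoid is an additive submonoid of $\mathbb{Q}_{\ge 0}$ (containing $0$). An atom of a Puiseux monoid $M$ is a nonzero element $a \in M$ such that $a = u+v$ with $u,v \in M$ implies $u = 0$ or $v = 0$; $\mathcal{A}(M)$ is the set of atoms, and $M$ is atomic if $\mathcal{A}(M)$ generates $M$. A factorization of $x \in M$ is a formal (unordered) sum $a_1 + \dots + a_n$ of atoms, i.e. an element of the free commutative monoid on $\mathcal{A}(M)$, whose value in $M$ is $x$; its length is $n$ (the empty sum, of length $0$, is the only factorization of $0$). The set of lengths $\mathsf{L}(x)$ is the set of all lengths of factorizations of $x$. Here $|\mathsf{L}(x)|$ denotes the cardinality of $\mathsf{L}(x)$, with $|\mathsf{L}(x)| = \infty$ meaning that $\mathsf{L}(x)$ is infinite. *)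

theory Defs
  imports Complex_Main "HOL-Library.Multiset" "HOL-Library.Extended_Nat"
begin

definition puiseux_monoid :: "rat set \<Rightarrow> bool" where
  "puiseux_monoid M \<longleftrightarrow>
     M \<subseteq> {0..} \<and> 0 \<in> M \<and> (\<forall>x\<in>M. \<forall>y\<in>M. x + y \<in> M)"

definition atoms :: "rat set \<Rightarrow> rat set" where
  "atoms M = {a \<in> M. a \<noteq> 0 \<and> (\<forall>u\<in>M. \<forall>v\<in>M. a = u + v \<longrightarrow> u = 0 \<or> v = 0)}"

(* The hull is the intersection of all submonoids of the nonnegative rationals
   containing the atoms, i.e. the submonoid they generate. *)
definition atomic :: "rat set \<Rightarrow> bool" where
  "atomic M \<longleftrightarrow> puiseux_monoid hull (atoms M) = M"

(* The free commutative monoid on the atoms consists of the finite multisets of atoms. *)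
definition factorizations :: "rat set \<Rightarrow> rat \<Rightarrow> rat multiset set" where
  "factorizations M x = {z. set_mset z \<subseteq> atoms M \<and> sum_mset z = x}"

definition lengths :: "rat set \<Rightarrow> rat \<Rightarrow> nat set" where
  "lengths M x = size ` factorizations M x"

(* card is 0 on infinite sets, hence the extended version. *)
definition ecard :: "'a set \<Rightarrow> enat" where
  "ecard A = (if finite A then enat (card A) else \<infinity>)"

end

(* Take M generated by the reciprocals 1/p of all primes p.  Clearing denominators, two sums of
   such reciprocals with the same value contain every 1/p equally often modulo p.  Hence an
   element one of whose factorizations uses some atom 1/p at least p times is of the form
   1 + y and inherits infinitely many lengths from 1 = q * (1/q), q prime, while any other
   element has exactly one factorization. *)
theory Submission
  imports Defs "HOL-Computational_Algebra.Primes"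
begin

section \<open>Sums of prime reciprocals and their multiplicities\<close>

definition rsum :: "nat multiset \<Rightarrow> rat" where
  "rsum A = (\<Sum>p\<in>#A. 1 / of_nat p)"

text \<open>These multisets stand in for factorizations: the primes themselves are recorded instead
  of their reciprocals, so that \<open>count A p\<close> can be compared modulo
  \<open>p\<close>.\<close>

definition prime_msets :: "nat multiset set" where
  "prime_msets = {A. \<forall>p\<in>#A. prime p}"

lemma rsum_simps [simp]:
  "rsum {#} = 0"
  "rsum (add_mset p A) = 1 / of_nat p + rsum A"
  "rsum (A + B) = rsum A + rsum B"
  by (simp_all add: rsum_def)

lemma prime_msets_simps [simp]:
  "{#} \<in> prime_msets"
  "add_mset p A \<in> prime_msets \<longleftrightarrow> prime p \<and> A \<in> prime_msets"
  "A + B \<in> prime_msets \<longleftrightarrow> A \<in> prime_msets \<and> B \<in> prime_msets"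
  by (auto simp: prime_msets_def)

lemma rsum_nonneg: "0 \<le> rsum A"
  by (induction A) auto

lemma rsum_eq_0_iff:
  assumes "A \<in> prime_msets"
  shows "rsum A = 0 \<longleftrightarrow> A = {#}"
proof (cases A)
  case (add p B)
  then have "0 < (1 :: rat) / of_nat p"
    using assms by (simp add: prime_gt_0_nat)
  then have "0 < rsum A"
    using add rsum_nonneg[of B] by (simp only: rsum_simps add_pos_nonneg)
  then show ?thesis
    using add by simp
qed simp

lemma rsum_replicate_self:
  assumes "0 < p"
  shows "rsum (replicate_mset p p) = 1"
  using assms by (simp add: rsum_def)

text \<open>For \<open>d\<close> take the product of the entries of \<open>A\<close> other than
  \<open>p\<close>, with multiplicity: it turns every summand except the copies of
  \<open>1 / p\<close> into an integer and stays coprime to \<open>p\<close>.\<close>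

lemma rsum_clear_denominators:
  assumes "A \<in> prime_msets" and "prime p"
  shows "\<exists>(d::nat) m::int. coprime d p \<and>
           of_nat d * rsum A = of_int m + of_nat d * of_nat (count A p) / of_nat p"
  using assms(1)
proof (induction A)
  case empty
  show ?case
    by (rule exI[of _ 1], rule exI[of _ 0]) simp
next
  case (add q A)
  then obtain d :: nat and m :: int where "coprime d p"
    and eq: "of_nat d * rsum A = of_int m + of_nat d * of_nat (count A p) / of_nat p"
    by auto
  show ?case
  proof (cases "q = p")
    case True
    then show ?thesis
      using \<open>coprime d p\<close> eq
      by (intro exI[of _ d] exI[of _ m]) (simp add: algebra_simps add_divide_distrib)
  next
    case False
    then have "coprime (q * d) p"
      using add.prems assms(2) \<open>coprime d p\<close> primes_coprime by auto
    \<comment> \<open>The extra factor \<open>q\<close> turns the new summand \<open>1 / q\<close>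
      into the integer \<open>d\<close> and multiplies the old identity by \<open>q\<close>.\<close>
    moreover have "of_nat (q * d) * rsum (add_mset q A) =
        of_nat d + of_nat q * (of_nat d * rsum A)"
      using add.prems by (auto simp: field_simps)
    then have "of_nat (q * d) * rsum (add_mset q A) = of_int (int q * m + int d) +
        of_nat (q * d) * of_nat (count (add_mset q A) p) / of_nat p"
      using False unfolding eq by (simp add: algebra_simps)
    ultimately show ?thesis
      by blast
  qed
qed

text \<open>After scaling by both denominators \<open>d\<close> and \<open>e\<close>, only the
  copies of \<open>1 / p\<close> can be non-integral. So \<open>p\<close> divides
  \<open>d * e\<close> times the difference of the counts, and \<open>d * e\<close> cancels by
  coprimality.\<close>

lemma rsum_eq_imp_count_mod_eq:
  assumes A: "A \<in> prime_msets" and B: "B \<in> prime_msets" and eq: "rsum A = rsum B"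
    and p: "prime p"
  shows "count A p mod p = count B p mod p"
proof -
  obtain d :: nat and m :: int where d: "coprime d p"
    and eqA: "of_nat d * rsum A = of_int m + of_nat d * of_nat (count A p) / of_nat p"
    using rsum_clear_denominators[OF A p] by auto
  obtain e :: nat and n :: int where e: "coprime e p"
    and eqB: "of_nat e * rsum B = of_int n + of_nat e * of_nat (count B p) / of_nat p"
    using rsum_clear_denominators[OF B p] by auto
  have p0: "(of_nat p :: rat) \<noteq> 0"
    using p by auto
  have "of_nat e * (of_nat d * rsum A) = of_nat d * (of_nat e * rsum B)"
    using eq by simp
  \<comment> \<open>Multiply by \<open>p\<close> as well and collect the integral parts on the left,
    the counts on the right.\<close>
  then have "(of_int (int p * (d * n - e * m)) :: rat) =
      of_int (int (d * e) * (int (count A p) - int (count B p)))"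
    unfolding eqA eqB using p0 by (simp add: field_simps)
  then have "int p * (d * n - e * m) = int (d * e) * (int (count A p) - int (count B p))"
    by (simp only: of_int_eq_iff)
  then have "int p dvd int (d * e) * (int (count A p) - int (count B p))"
    by (metis dvd_triv_left)
  moreover have "coprime (int p) (int (d * e))"
    using d e by (simp add: coprime_commute)
  ultimately have "int p dvd int (count A p) - int (count B p)"
    using coprime_dvd_mult_right_iff by blast
  then have "int (count A p) mod int p = int (count B p) mod int p"
    by (simp add: mod_eq_dvd_iff)
  then show ?thesis
    by (metis of_nat_eq_iff zmod_int)
qed

text \<open>The count of \<open>p\<close> in \<open>A\<close> is congruent to 1 modulo
  \<open>p\<close>, so \<open>p\<close> occurs in \<open>A\<close>; the remaining entries sum to 0
  and hence are absent. This is what makes \<open>1 / p\<close> an atom.\<close>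

lemma rsum_eq_prime_reciprocal:
  assumes A: "A \<in> prime_msets" and p: "prime p" and eq: "rsum A = 1 / of_nat p"
  shows "A = {#p#}"
proof -
  have "count A p mod p = count {#p#} p mod p"
    using assms by (intro rsum_eq_imp_count_mod_eq) auto
  then have "count A p \<noteq> 0"
    using prime_gt_1_nat[OF p] by (intro notI) simp
  then obtain B where B: "A = add_mset p B"
    by (metis multi_member_split not_in_iff)
  then have "rsum B = 0"
    using eq by simp
  then show ?thesis
    using A B by (simp add: rsum_eq_0_iff)
qed

text \<open>A count below \<open>p\<close> is determined by its residue modulo
  \<open>p\<close>.\<close>

lemma prime_msets_eqI:
  assumes "A \<in> prime_msets" "B \<in> prime_msets" "rsum A = rsum B"
    and "\<And>p. prime p \<Longrightarrow> count A p < p" "\<And>p. prime p \<Longrightarrow> count B p < p"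
  shows "A = B"
proof (rule multiset_eqI)
  fix p
  show "count A p = count B p"
  proof (cases "prime p")
    case True
    then show ?thesis
      using rsum_eq_imp_count_mod_eq[OF assms(1-3) True] assms(4,5) by simp
  next
    case False
    then have "p \<notin># A" "p \<notin># B"
      using assms(1,2) by (auto simp: prime_msets_def)
    then show ?thesis
      by (simp add: not_in_iff)
  qed
qed

section \<open>The monoid, its atoms and atomicity\<close>

definition prime_reciprocal_monoid :: "rat set" where
  "prime_reciprocal_monoid = rsum ` prime_msets"

lemma puiseux_prime_reciprocal_monoid: "puiseux_monoid prime_reciprocal_monoid"
proof -
  have "rsum A + rsum B \<in> rsum ` prime_msets"
    if "A \<in> prime_msets" "B \<in> prime_msets" for A B
    using that by (intro image_eqI[of _ _ "A + B"]) auto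
  moreover have "0 \<in> rsum ` prime_msets"
    by (intro image_eqI[of _ _ "{#}"]) auto
  ultimately show ?thesis
    by (auto simp: puiseux_monoid_def prime_reciprocal_monoid_def rsum_nonneg)
qed

lemma prime_reciprocal_in_monoid:
  assumes "prime p"
  shows "1 / of_nat p \<in> prime_reciprocal_monoid"
  unfolding prime_reciprocal_monoid_def
  using assms by (intro image_eqI[of _ _ "{#p#}"]) auto

lemma atoms_prime_reciprocal_monoid:
  "atoms prime_reciprocal_monoid = (\<lambda>p. 1 / of_nat p) ` {p::nat. prime p}"
proof (intro equalityI subsetI)
  fix a assume a: "a \<in> atoms prime_reciprocal_monoid"
  then obtain A where A: "A \<in> prime_msets" "a = rsum A"
    by (auto simp: atoms_def prime_reciprocal_monoid_def)
  \<comment> \<open>An atom is nonzero, so \<open>A\<close> has an entry to split off; as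
    \<open>1 / q\<close> is nonzero, the rest must sum to 0.\<close>
  then obtain q B where B: "A = add_mset q B"
    using a by (cases A) (auto simp: atoms_def)
  then have "prime q" "B \<in> prime_msets" and eq: "a = 1 / of_nat q + rsum B"
    using A by auto
  then have "1 / of_nat q \<in> prime_reciprocal_monoid" "rsum B \<in> prime_reciprocal_monoid"
    using prime_reciprocal_in_monoid by (auto simp: prime_reciprocal_monoid_def)
  then have "1 / of_nat q = (0::rat) \<or> rsum B = 0"
    using a eq unfolding atoms_def by blast
  then have "a = 1 / of_nat q"
    using eq \<open>prime q\<close> by auto
  then show "a \<in> (\<lambda>p. 1 / of_nat p) ` {p::nat. prime p}"
    using \<open>prime q\<close> by blast
next
  fix a :: rat assume "a \<in> (\<lambda>p. 1 / of_nat p) ` {p::nat. prime p}"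
  then obtain p :: nat where p: "prime p" and a: "a = 1 / of_nat p"
    by blast
  have "u = 0 \<or> v = 0"
    if uv: "u \<in> prime_reciprocal_monoid" "v \<in> prime_reciprocal_monoid" "a = u + v" for u v
  proof -
    obtain U V where UV: "U \<in> prime_msets" "V \<in> prime_msets" "u = rsum U" "v = rsum V"
      using uv by (auto simp: prime_reciprocal_monoid_def)
    then have "U + V = {#p#}"
      using p a uv(3) by (intro rsum_eq_prime_reciprocal) auto
    then have "U = {#} \<or> V = {#}"
      by (auto simp: union_is_single)
    then show ?thesis
      using UV by auto
  qed
  then show "a \<in> atoms prime_reciprocal_monoid"
    using p a prime_reciprocal_in_monoid by (auto simp: atoms_def)
qed

lemma atomic_prime_reciprocal_monoid: "atomic prime_reciprocal_monoid"
proof -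
  let ?M = prime_reciprocal_monoid
  \<comment> \<open>The hull is an intersection, so membership is checked in an arbitrary submonoid
    \<open>N\<close> containing the atoms.\<close>
  have "rsum A \<in> N" if "A \<in> prime_msets" "puiseux_monoid N" "atoms ?M \<subseteq> N" for A N
    using that by (induction A) (auto simp: puiseux_monoid_def atoms_prime_reciprocal_monoid)
  then have "?M \<subseteq> puiseux_monoid hull atoms ?M"
    by (auto simp: prime_reciprocal_monoid_def hull_def)
  moreover have "puiseux_monoid hull atoms ?M \<subseteq> ?M"
    using puiseux_prime_reciprocal_monoid by (intro hull_minimal) (auto simp: atoms_def)
  ultimately show ?thesis
    by (simp add: atomic_def)
qed

section \<open>Factorizations and sets of lengths\<close>

lemma factorizations_prime_reciprocal_monoid:
  "factorizations prime_reciprocal_monoid x =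
     image_mset (\<lambda>p. 1 / of_nat p) ` {A \<in> prime_msets. rsum A = x}"
proof -
  \<comment> \<open>Every atom is a prime reciprocal, so a multiset of atoms lifts entry by entry to
    a multiset of primes.\<close>
  have "\<exists>A\<in>prime_msets. z = image_mset (\<lambda>p. 1 / of_nat p) A"
    if "set_mset z \<subseteq> (\<lambda>p. 1 / of_nat p) ` {p::nat. prime p}" for z :: "rat multiset"
    using that
  proof (induction z)
    case empty
    show ?case
      by (rule bexI[of _ "{#}"]) auto
  next
    case (add a z)
    then obtain A p where "A \<in> prime_msets" "z = image_mset (\<lambda>p. 1 / of_nat p) A"
      "prime p" "a = 1 / of_nat p"
      by auto
    then show ?case
      by (intro bexI[of _ "add_mset p A"]) auto
  qed
  then have "factorizations prime_reciprocal_monoid x \<subseteq>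
      image_mset (\<lambda>p. 1 / of_nat p) ` {A \<in> prime_msets. rsum A = x}"
    unfolding factorizations_def atoms_prime_reciprocal_monoid rsum_def by blast
  moreover have "image_mset (\<lambda>p. 1 / of_nat p) ` {A \<in> prime_msets. rsum A = x} \<subseteq>
      factorizations prime_reciprocal_monoid x"
    by (auto simp: factorizations_def atoms_prime_reciprocal_monoid rsum_def prime_msets_def)
  ultimately show ?thesis
    by blast
qed

lemma lengths_prime_reciprocal_monoid:
  "lengths prime_reciprocal_monoid x = size ` {A \<in> prime_msets. rsum A = x}"
  by (simp add: lengths_def factorizations_prime_reciprocal_monoid image_image)

text \<open>For each prime \<open>p\<close> the summand 1 can be written as \<open>p\<close> copies
  of \<open>1 / p\<close>, which gives the length \<open>size A + p\<close>.\<close>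

lemma infinite_lengths_add_one:
  assumes "A \<in> prime_msets"
  shows "infinite (lengths prime_reciprocal_monoid (rsum A + 1))"
proof -
  have "(\<lambda>p. size A + p) ` {p::nat. prime p} \<subseteq> lengths prime_reciprocal_monoid (rsum A + 1)"
  proof clarify
    fix p :: nat assume p: "prime p"
    then have "replicate_mset p p \<in> prime_msets"
      by (simp add: prime_msets_def)
    then show "size A + p \<in> lengths prime_reciprocal_monoid (rsum A + 1)"
      unfolding lengths_prime_reciprocal_monoid using assms p
      by (intro image_eqI[of _ _ "A + replicate_mset p p"])
        (auto simp: rsum_replicate_self prime_gt_0_nat)
  qed
  moreover have "infinite ((\<lambda>p. size A + p) ` {p::nat. prime p})"
    using primes_infinite by (subst finite_image_iff) (auto simp: inj_on_def)
  ultimately show ?thesis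
    using finite_subset by blast
qed

lemma lengths_dichotomy:
  assumes "x \<in> prime_reciprocal_monoid"
  shows "infinite (lengths prime_reciprocal_monoid x) \<or>
    (\<exists>n. lengths prime_reciprocal_monoid x = {n})"
proof (cases "\<exists>A\<in>prime_msets. rsum A = x \<and> (\<exists>p. prime p \<and> p \<le> count A p)")
  case True
  then obtain A p where A: "A \<in> prime_msets" "rsum A = x" and p: "prime p" "p \<le> count A p"
    by blast
  then obtain B where B: "A = B + replicate_mset p p"
    by (metis count_le_replicate_mset_subset_eq subset_mset.diff_add)
  then have "B \<in> prime_msets" "x = rsum B + 1"
    using A p by (auto simp: rsum_replicate_self prime_gt_0_nat)
  then show ?thesis
    using infinite_lengths_add_one by blast
next
  case False
  obtain A where A: "A \<in> prime_msets" "rsum A = x"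
    using assms by (auto simp: prime_reciprocal_monoid_def)
  \<comment> \<open>The failed case distinction bounds the counts in every multiset with sum
    \<open>x\<close>, hence in both \<open>A\<close> and \<open>B\<close>.\<close>
  have "B = A" if "B \<in> prime_msets" "rsum B = x" for B
    using that A False by (intro prime_msets_eqI) (auto simp: not_le)
  then have "{A \<in> prime_msets. rsum A = x} = {A}"
    using A by blast
  then show ?thesis
    by (simp add: lengths_prime_reciprocal_monoid)
qed

theorem corollary5p6:
  shows "\<exists>M :: rat set. puiseux_monoid M \<and> atomic M \<and>
           {ecard (lengths M x) | x. x \<in> M} = {1, \<infinity>}"
proof (intro exI conjI)
  let ?M = prime_reciprocal_monoid
  \<comment> \<open>The elements 0 and 1 realize the two cardinalities; 1 lies in the monoid as 1/2
    + 1/2.\<close>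
  have zero: "0 \<in> ?M" and one: "1 \<in> ?M"
    using rsum_replicate_self[of 2]
    by (auto simp: prime_reciprocal_monoid_def prime_msets_def
        intro: image_eqI[of _ _ "{#}"] image_eqI[of _ _ "replicate_mset 2 2"])
  have "{A \<in> prime_msets. rsum A = 0} = {{#}}"
    by (auto simp: rsum_eq_0_iff)
  then have "ecard (lengths ?M 0) = 1"
    by (simp add: lengths_prime_reciprocal_monoid ecard_def one_enat_def)
  moreover have "ecard (lengths ?M 1) = \<infinity>"
    using infinite_lengths_add_one[of "{#}"] by (simp add: ecard_def)
  moreover have "ecard (lengths ?M x) \<in> {1, \<infinity>}" if "x \<in> ?M" for x
    using lengths_dichotomy[OF that] by (auto simp: ecard_def one_enat_def)
  ultimately show "{ecard (lengths ?M x) | x. x \<in> ?M} = {1, \<infinity>}"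
    using zero one by (auto 4 4 intro: sym)
qed (fact puiseux_prime_reciprocal_monoid atomic_prime_reciprocal_monoid)+

end
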